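(* Let $0<x<\pi/2$. For every integer $p\ge 3$, the two double inequalities $$\frac{4}{\pi^2}<\frac{1-\frac{\cos x}{\cos (x/p)}}{x^2}<\frac{p^2-1}{2p^2}$$ and $$\frac{4}{\pi^2}\left(p-\csc\left(\frac{\pi}{2p}\right)\right)<\frac{p-\frac{\sin x}{\sin (x/p)}}{x^2}<\frac{p^2-1}{6p}$$ hold. Moreover, for $p=2$ the second double inequality remains true, while the first is reversed, i.e. for $p=2$ $$\frac{p^2-1}{2p^2}<\frac{1-\frac{\cos x}{\cos (x/p)}}{x^2}<\frac{4}{\pi^2}.$$ *)

theory Defs
  imports Complex_Main
begin

definition csc :: "real \<Rightarrow> real" where
  "csc x = 1 / sin x"

end

theory Submission
  imports Defs
begin

text \<open>
  Since \<open>p\<close> is an integer, \<open>sin (p t) / sin t\<close> is the sum of the \<open>p\<close> cosines \<open>cos ((p - 1 - 2 j) t)\<close>,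
  so the sine inequalities follow termwise from the fact that \<open>(1 - cos u) / u\<^sup>2\<close> decreases from
  \<open>1 / 2\<close>. For the cosine quotient with \<open>p \<ge> 3\<close>, the lower bound is worst at \<open>p = 3\<close>, where
  \<open>1 - cos x / cos (x / 3) = 4 sin\<^sup>2 (x / 3)\<close>, and the upper bound follows from Taylor polynomials.
  For \<open>p = 2\<close> the upper bound holds because \<open>(1 - cos (2 t) / cos t) / t\<^sup>2\<close> is increasing in \<open>t\<close>;
  the lower one is again a comparison of Taylor polynomials.
\<close>

section \<open>Elementary bounds for sine and cosine\<close>

text \<open>Mean value theorem between 0 and \<open>t\<close>. The sign of \<open>f'\<close> is
  asked only for \<open>s > 0\<close>, because the derivatives it is applied to vanish at 0.\<close>

lemma pos_if_deriv_pos: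
  fixes f f' :: "real \<Rightarrow> real"
  assumes "f 0 = 0" "0 < t" "t < b"
    and "\<And>s. 0 \<le> s \<Longrightarrow> s < b \<Longrightarrow> (f has_real_derivative f' s) (at s)"
    and "\<And>s. 0 < s \<Longrightarrow> s < b \<Longrightarrow> f' s > 0"
  shows "f t > 0"
proof -
  obtain z where "0 < z" "z < t" "f t - f 0 = (t - 0) * f' z"
    using MVT2[of 0 t f f'] assms by force
  then show ?thesis using assms by simp
qed

text \<open>The chord slopes of sine over \<open>[0, u]\<close> and \<open>[u, v]\<close> are
  \<open>cos a > cos b\<close>, by concavity. Cross-multiplied form of the decrease of
  \<open>sin u / u\<close>.\<close>

lemma sin_ratio_decreasing:
  fixes u v :: real
  assumes "0 < u" "u < v" "v \<le> pi"
  shows "u * sin v < v * sin u"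
proof -
  obtain a where a: "0 < a" "a < u" "sin u - sin 0 = (u - 0) * cos a"
    using MVT2[of 0 u sin cos] assms by (force intro: DERIV_sin)
  obtain b where b: "u < b" "b < v" "sin v - sin u = (v - u) * cos b"
    using MVT2[of u v sin cos] assms by (force intro: DERIV_sin)
  have "cos b < cos a"
    using a b assms by (intro cos_monotone_0_pi) auto
  then have "u * ((v - u) * cos b) < u * ((v - u) * cos a)"
    using assms by simp
  then have "u * (sin v - sin u) < (v - u) * (u * cos a)"
    by (simp add: b mult.left_commute)
  then show ?thesis using a by (simp add: algebra_simps)
qed

lemma one_minus_cos_eq: "1 - cos u = 2 * (sin (u / 2))\<^sup>2" for u :: real
  using cos_double_sin[of "u / 2"] by simp

text \<open>With \<open>v = \<bar>u\<bar> / 2\<close>, the ratio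
  \<open>(1 - cos u) / u\<^sup>2\<close> is half the square of \<open>sin v / v\<close>, hence grows
  when \<open>u\<close> shrinks to \<open>l * u\<close>.\<close>

lemma one_minus_cos_scaled_greater:
  fixes u l :: real
  assumes "0 < l" "l < 1" "u \<noteq> 0" "\<bar>u\<bar> \<le> pi"
  shows "l\<^sup>2 * (1 - cos u) < 1 - cos (l * u)"
proof -
  define v where "v = \<bar>u\<bar> / 2"
  have v: "0 < v" "v \<le> pi" using assms by (auto simp: v_def)
  have "(l * v) * sin v < v * sin (l * v)"
    using v assms by (intro sin_ratio_decreasing) auto
  then have "l * sin v < sin (l * v)" using v by (simp add: mult.assoc mult.left_commute)
  moreover have "0 \<le> l * sin v" using v assms by (simp add: sin_ge_zero)
  ultimately have "(l * sin v)\<^sup>2 < (sin (l * v))\<^sup>2" by (simp add: power_strict_mono)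
  moreover have "1 - cos u = 2 * (sin v)\<^sup>2"
    using one_minus_cos_eq[of "\<bar>u\<bar>"] by (simp add: v_def)
  moreover have "1 - cos (l * u) = 2 * (sin (l * v))\<^sup>2"
  proof -
    have "\<bar>l * u\<bar> / 2 = l * v" using assms by (simp add: v_def abs_mult)
    then show ?thesis using one_minus_cos_eq[of "\<bar>l * u\<bar>"] by (simp only: cos_abs_real)
  qed
  ultimately show ?thesis by (simp add: power_mult_distrib)
qed

lemma one_minus_cos_less:
  fixes u :: real
  assumes "u \<noteq> 0"
  shows "1 - cos u < u\<^sup>2 / 2"
\<comment> \<open>Up to 2 the Lagrange point \<open>t\<close> lies in \<open>(0, pi)\<close>, so
  \<open>cos t < 1\<close> is strict; beyond 2 the trivial bound \<open>1 - cos u \<le> 2\<close>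
  suffices.\<close>
proof (cases "\<bar>u\<bar> \<le> 2")
  case True
  obtain t where t: "0 < t" "t < \<bar>u\<bar>"
    "cos \<bar>u\<bar> = (\<Sum>m<2. cos_coeff m * \<bar>u\<bar> ^ m) + cos (t + 1/2 * real 2 * pi) / fact 2 * \<bar>u\<bar> ^ 2"
    using Maclaurin_cos_expansion2[of "\<bar>u\<bar>" 2] assms by auto
  have "cos t < 1"
    using cos_monotone_0_pi[of 0 t] t True pi_ge_two by simp
  then have "cos t * u\<^sup>2 < 1 * u\<^sup>2"
    using assms by (intro mult_strict_right_mono) auto
  moreover have "cos u = 1 - cos t * u\<^sup>2 / 2"
    using t(3) by (simp add: numeral_eq_Suc cos_coeff_def)
  ultimately show ?thesis by simp
next
  case False
  then have "2\<^sup>2 < \<bar>u\<bar>\<^sup>2" by (intro power_strict_mono) auto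
  then have "4 < u\<^sup>2" unfolding power2_abs by simp
  then show ?thesis using cos_ge_minus_one[of u] by linarith
qed

lemma cos_le_Taylor4:
  fixes x :: real
  assumes "0 < x"
  shows "cos x \<le> 1 - x\<^sup>2 / 2 + x ^ 4 / 24"
proof -
  obtain t where "cos x = (\<Sum>m<4. cos_coeff m * x ^ m) + cos (t + 1/2 * real 4 * pi) / fact 4 * x ^ 4"
    using Maclaurin_cos_expansion2[of x 4] assms by auto
  also have "(\<Sum>m<4. cos_coeff m * x ^ m) = 1 - x\<^sup>2 / 2"
    by (simp add: lessThan_nat_numeral cos_coeff_def fact_numeral)
  also have "cos (t + 1/2 * real 4 * pi) / fact 4 * x ^ 4 \<le> 1 / fact 4 * x ^ 4"
    by (intro mult_right_mono divide_right_mono) auto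
  finally show ?thesis by (simp add: fact_numeral)
qed

lemma cos_ge_Taylor6:
  fixes x :: real
  assumes "0 < x"
  shows "1 - x\<^sup>2 / 2 + x ^ 4 / 24 - x ^ 6 / 720 \<le> cos x"
proof -
  obtain t where t: "cos x = (\<Sum>m<6. cos_coeff m * x ^ m) + cos (t + 1/2 * real 6 * pi) / fact 6 * x ^ 6"
    using Maclaurin_cos_expansion2[of x 6] assms by auto
  have "(\<Sum>m<6. cos_coeff m * x ^ m) = 1 - x\<^sup>2 / 2 + x ^ 4 / 24"
    by (simp add: lessThan_nat_numeral cos_coeff_def fact_numeral)
  moreover have "- 1 / fact 6 * x ^ 6 \<le> cos (t + 1/2 * real 6 * pi) / fact 6 * x ^ 6"
    by (intro mult_right_mono divide_right_mono) auto
  then have "- (x ^ 6 / 720) \<le> cos (t + 1/2 * real 6 * pi) / fact 6 * x ^ 6"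
    by (simp add: fact_numeral)
  ultimately show ?thesis using t by linarith
qed

section \<open>The sine quotient\<close>

text \<open>The identity \<open>2 * sin t * cos w = sin (w + t) - sin (w - t)\<close> makes the sum
  telescope, from \<open>g 0 = sin (n * t)\<close> to \<open>g n = - sin (n * t)\<close>.\<close>

lemma sin_multiple_eq_sum_cos:
  fixes t :: real
  shows "sin (real n * t) = sin t * (\<Sum>j<n. cos ((real n - 1 - 2 * real j) * t))"
proof -
  define g where "g = (\<lambda>j. sin ((real n - 2 * real j) * t))"
  have "2 * (sin t * cos ((real n - 1 - 2 * real j) * t)) = g j - g (Suc j)" for j
  proof -
    define w where "w = (real n - 1 - 2 * real j) * t"
    have "g j = sin (w + t)" "g (Suc j) = sin (w - t)"
      by (simp_all add: g_def w_def algebra_simps)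
    then show ?thesis
      by (simp add: w_def [symmetric] sin_add sin_diff)
  qed
  then have "2 * (sin t * (\<Sum>j<n. cos ((real n - 1 - 2 * real j) * t))) = (\<Sum>j<n. g j - g (Suc j))"
    by (simp add: sum_distrib_left)
  also have "\<dots> = 2 * sin (real n * t)"
    by (simp only: sum_lessThan_telescope') (simp add: g_def)
  finally show ?thesis by simp
qed

text \<open>Needed for \<open>c = n - 1\<close> and \<open>m = n\<close>; keeping \<open>c\<close>
  free of \<open>m\<close> is what lets the induction go through.\<close>

lemma sum_squares_arith_progression:
  fixes c :: real
  shows "3 * (\<Sum>j<m. (c - 2 * real j)\<^sup>2)
    = real m * (3 * c\<^sup>2 - 6 * c * (real m - 1) + 2 * (real m - 1) * (2 * real m - 1))"
proof (induction m)
  case (Suc m)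
  have "3 * (\<Sum>j<Suc m. (c - 2 * real j)\<^sup>2) = 3 * (\<Sum>j<m. (c - 2 * real j)\<^sup>2) + 3 * (c - 2 * real m)\<^sup>2"
    by simp
  also have "\<dots> = real (Suc m) * (3 * c\<^sup>2 - 6 * c * (real (Suc m) - 1)
      + 2 * (real (Suc m) - 1) * (2 * real (Suc m) - 1))"
    unfolding Suc.IH of_nat_Suc by algebra
  finally show ?case .
qed simp

lemma sin_quotient_deficit:
  fixes t :: real
  assumes "sin t \<noteq> 0"
  shows "real n - sin (real n * t) / sin t = (\<Sum>j<n. 1 - cos ((real n - 1 - 2 * real j) * t))"
  using assms sin_multiple_eq_sum_cos[of n t] by (simp add: sum_subtractf)

lemma sin_quotient_bounds:
  fixes x :: real
  assumes x: "0 < x" "x < pi / 2" and n: "2 \<le> n"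
  shows "4 / pi\<^sup>2 * (real n - csc (pi / (2 * real n))) < (real n - sin x / sin (x / real n)) / x\<^sup>2"
    and "(real n - sin x / sin (x / real n)) / x\<^sup>2 < ((real n)\<^sup>2 - 1) / (6 * real n)"
proof -
  define a where "a = (\<lambda>j. real n - 1 - 2 * real j)"
  \<comment> \<open>\<open>l\<close> is the ratio of \<open>x\<close> to the endpoint
    \<open>pi / 2\<close>, and \<open>y\<close> is the value of \<open>x / n\<close> at that
    endpoint, where the quotient becomes \<open>csc y\<close>.\<close>
  define l where "l = 2 * x / pi"
  define y where "y = pi / (2 * real n)"
  have l: "0 < l" "l < 1" using x by (auto simp: l_def)
  have n0: "real n > 0" using n by simp
  have y: "0 < y" "y < pi" using n by (auto simp: y_def field_simps)
  have xn: "x / real n = l * y" using n by (simp add: l_def y_def)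
  have "l * y < 1 * y" using l y by (intro mult_strict_right_mono)
  then have "l * y < pi" using y by linarith
  then have s: "sin (l * y) > 0" "sin y > 0" using l y by (auto intro!: sin_gt_zero)
  have *: "real n - sin x / sin (x / real n) = (\<Sum>j<n. 1 - cos (l * (a j * y)))"
  proof -
    have "real n * (l * y) = x" unfolding xn[symmetric] using n by simp
    then show ?thesis
      unfolding xn using sin_quotient_deficit[of "l * y" n] s by (simp add: a_def mult.left_commute)
  qed
  have **: "real n - csc y = (\<Sum>j<n. 1 - cos (a j * y))"
  proof -
    have "real n * y = pi / 2" using n by (simp add: y_def)
    then have "sin (real n * y) = 1" by (simp only: sin_pi_half)
    then show ?thesis
      using sin_quotient_deficit[of y n] s by (simp add: csc_def a_def)
  qed
  have a: "\<bar>a j\<bar> * y \<le> pi" if "j < n" for j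
  proof -
    have "\<bar>a j\<bar> \<le> real n" using that by (auto simp: a_def)
    then have "\<bar>a j\<bar> * y \<le> real n * y" using y by (intro mult_right_mono) auto
    also have "\<dots> = pi / 2" using n by (simp add: y_def)
    finally show ?thesis using pi_gt_zero by linarith
  qed
  \<comment> \<open>For odd \<open>n\<close> the middle frequency is 0 and its term gives equality
    in both comparisons; strictness of the sums is therefore drawn from index 0, where
    \<open>a 0 = n - 1\<close>.\<close>
  have a0: "a 0 \<noteq> 0" using n by (simp add: a_def)
  have less: "l\<^sup>2 * (1 - cos (a j * y)) < 1 - cos (l * (a j * y))" if "j < n" "a j \<noteq> 0" for j
    using that l y a[of j] by (intro one_minus_cos_scaled_greater) (auto simp: abs_mult)
  have "(\<Sum>j<n. l\<^sup>2 * (1 - cos (a j * y))) < (\<Sum>j<n. 1 - cos (l * (a j * y)))"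
  proof (rule sum_strict_mono_ex1)
    show "\<forall>j\<in>{..<n}. l\<^sup>2 * (1 - cos (a j * y)) \<le> 1 - cos (l * (a j * y))"
    proof
      fix j assume "j \<in> {..<n}"
      then show "l\<^sup>2 * (1 - cos (a j * y)) \<le> 1 - cos (l * (a j * y))"
        using less[of j] by (cases "a j = 0") auto
    qed
    show "\<exists>j\<in>{..<n}. l\<^sup>2 * (1 - cos (a j * y)) < 1 - cos (l * (a j * y))"
      using less[of 0] a0 n by (intro bexI[of _ 0]) auto
  qed simp
  then have "l\<^sup>2 * (real n - csc y) < real n - sin x / sin (x / real n)"
    by (simp only: * ** sum_distrib_left)
  moreover have "l\<^sup>2 = 4 / pi\<^sup>2 * x\<^sup>2"
    by (simp add: l_def power_divide power_mult_distrib)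
  ultimately have "4 / pi\<^sup>2 * (real n - csc y) * x\<^sup>2 < real n - sin x / sin (x / real n)"
    by (simp only: mult.assoc mult.commute mult.left_commute)
  then show "4 / pi\<^sup>2 * (real n - csc (pi / (2 * real n))) < (real n - sin x / sin (x / real n)) / x\<^sup>2"
    using x unfolding y_def by (subst pos_less_divide_eq) simp_all
  have "(\<Sum>j<n. 1 - cos (l * (a j * y))) < (\<Sum>j<n. (l * (a j * y))\<^sup>2 / 2)"
  proof (rule sum_strict_mono_ex1)
    have less': "1 - cos (l * (a j * y)) < (l * (a j * y))\<^sup>2 / 2" if "a j \<noteq> 0" for j
      using that l y by (intro one_minus_cos_less) auto
    show "\<forall>j\<in>{..<n}. 1 - cos (l * (a j * y)) \<le> (l * (a j * y))\<^sup>2 / 2"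
    proof
      fix j
      show "1 - cos (l * (a j * y)) \<le> (l * (a j * y))\<^sup>2 / 2"
        using less'[of j] by (cases "a j = 0") auto
    qed
    show "\<exists>j\<in>{..<n}. 1 - cos (l * (a j * y)) < (l * (a j * y))\<^sup>2 / 2"
      using less'[OF a0] n by (intro bexI[of _ 0]) auto
  qed simp
  also have "(\<Sum>j<n. (l * (a j * y))\<^sup>2 / 2) = (\<Sum>j<n. (l * y)\<^sup>2 / 2 * (a j)\<^sup>2)"
    by (intro sum.cong) (simp_all add: power_mult_distrib)
  also have "\<dots> = (l * y)\<^sup>2 / 2 * (\<Sum>j<n. (a j)\<^sup>2)"
    by (simp only: sum_distrib_left)
  also have "(\<Sum>j<n. (a j)\<^sup>2) = real n * ((real n)\<^sup>2 - 1) / 3"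
    using sum_squares_arith_progression[of "real n - 1" n]
    by (simp add: a_def algebra_simps power2_eq_square)
  also have "(l * y)\<^sup>2 / 2 * (real n * ((real n)\<^sup>2 - 1) / 3) = ((real n)\<^sup>2 - 1) / (6 * real n) * x\<^sup>2"
    unfolding xn[symmetric] using n0 by (simp add: power2_eq_square)
  finally show "(real n - sin x / sin (x / real n)) / x\<^sup>2 < ((real n)\<^sup>2 - 1) / (6 * real n)"
    using x by (simp only: *) (simp add: pos_divide_less_eq)
qed

section \<open>The cosine quotient\<close>

text \<open>Since \<open>cos x > 0\<close> and \<open>cos (q * x) \<ge> cos (x / 3)\<close>, the
  quotient is at most its value at \<open>q = 1 / 3\<close>, which the triple-angle formula
  evaluates.\<close>

lemma cos_quotient_lower:
  fixes x q :: real
  assumes x: "0 < x" "x < pi / 2" and q: "0 < q" "q \<le> 1 / 3"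
  shows "4 / pi\<^sup>2 < (1 - cos x / cos (q * x)) / x\<^sup>2"
proof -
  define t where "t = x / 3"
  have t: "0 < t" "t < pi / 6" "x = 3 * t" using x by (auto simp: t_def)
  have "q * x \<le> t" using q x mult_right_mono[of q "1/3" x] by (simp add: t_def)
  then have "cos t \<le> cos (q * x)" using q x t by (intro cos_monotone_0_pi_le) auto
  moreover have ct: "cos t > 0" using t by (intro cos_gt_zero_pi) auto
  moreover have "cos x > 0" using x by (intro cos_gt_zero_pi) auto
  ultimately have "cos x / cos (q * x) \<le> cos x / cos t"
    by (intro divide_left_mono) auto
  also have "cos x / cos t = 1 - 4 * (sin t)\<^sup>2"
  proof -
    have "cos x = cos t * (1 - 4 * (sin t)\<^sup>2)"
      unfolding t cos_treble_cos sin_squared_eq by (simp add: algebra_simps power2_eq_square power3_eq_cube)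
    then show ?thesis using ct by simp
  qed
  \<comment> \<open>Comparison with the endpoint \<open>pi / 6\<close>, where sine is
    \<open>1 / 2\<close>; this is the source of the constant \<open>4 / pi\<^sup>2\<close>.\<close>
  also have "t * sin (pi / 6) < pi / 6 * sin t"
    using t by (intro sin_ratio_decreasing) auto
  then have "x / pi < sin t" using t by (simp add: sin_30 field_simps)
  then have "(x / pi)\<^sup>2 < (sin t)\<^sup>2" using x by (intro power_strict_mono) auto
  then have "1 - 4 * (sin t)\<^sup>2 < 1 - 4 * (x / pi)\<^sup>2" by simp
  finally show ?thesis
    using x by (simp add: pos_less_divide_eq power_divide)
qed

text \<open>Clearing the denominator leaves
  \<open>cos (q * x) * (1 - (1 - s) / 2 * X) < cos x\<close>, a polynomial inequality in
  \<open>X\<close> and \<open>s\<close> once Taylor bounds are inserted.\<close>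

lemma cos_quotient_upper:
  fixes x q :: real
  assumes x: "0 < x" "x < pi / 2" and q: "0 < q" "q \<le> 1 / 3"
  shows "(1 - cos x / cos (q * x)) / x\<^sup>2 < (1 - q\<^sup>2) / 2"
proof -
  define X where "X = x\<^sup>2"
  define s where "s = q\<^sup>2"
  have "x < 2" using x pi_less_4 by simp
  then have X: "0 < X" "X < 4"
    using x power_strict_mono[of x 2 2] by (auto simp: X_def)
  have s: "0 < s" "s \<le> 1 / 9"
    using q power_mono[of q "1/3" 2] by (auto simp: s_def power2_eq_square)
  have cx: "cos x > 0" using x by (intro cos_gt_zero_pi) auto
  have "q * x \<le> 1 * x" using q x by (intro mult_right_mono) auto
  then have cq: "cos (q * x) > 0"
    using x q mult_pos_pos[of q x] by (intro cos_gt_zero_pi) linarith+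
  have pw: "x ^ 4 = X\<^sup>2" "x ^ 6 = X ^ 3" "(q * x)\<^sup>2 = s * X" "(q * x) ^ 4 = (s * X)\<^sup>2"
    by (simp_all add: X_def s_def power_mult_distrib flip: power_mult)
  \<comment> \<open>The Taylor bound for \<open>cos (q * x)\<close> may be multiplied only by a
    nonnegative factor; otherwise the left side is at most 0.\<close>
  have "cos (q * x) * (1 - (1 - s) / 2 * X) < cos x"
  proof (cases "1 - (1 - s) / 2 * X > 0")
    case False
    then have "cos (q * x) * (1 - (1 - s) / 2 * X) \<le> 0"
      using cq by (intro mult_nonneg_nonpos) auto
    then show ?thesis using cx by simp
  next
    case True
    have "cos (q * x) * (1 - (1 - s) / 2 * X)
        \<le> (1 - s * X / 2 + (s * X)\<^sup>2 / 24) * (1 - (1 - s) / 2 * X)"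
      using cos_le_Taylor4[of "q * x"] q x True pw by (intro mult_right_mono) auto
    also have "\<dots> = 1 - X / 2 + X\<^sup>2 / 24 - X ^ 3 / 720
        - X\<^sup>2 / 720 * (30 * ((1 - s) * (1 - 5 * s)) - X) - X ^ 3 * s\<^sup>2 * (1 - s) / 48"
      by (simp add: field_simps power2_eq_square power3_eq_cube)
    \<comment> \<open>For \<open>s \<le> 1 / 9\<close> the bracket is at least
      \<open>30 * 32 / 81 - X\<close>, positive because \<open>X < 4\<close>. At
      \<open>s = 1 / 4\<close>, that is \<open>p = 2\<close>, the factor \<open>1 - 5 * s\<close> is
      negative, in line with the reversal there.\<close>
    also have "\<dots> < 1 - X / 2 + X\<^sup>2 / 24 - X ^ 3 / 720"
    proof -
      have "8 / 9 * (4 / 9) \<le> (1 - s) * (1 - 5 * s)"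
        using s by (intro mult_mono) auto
      then have "0 < X\<^sup>2 / 720 * (30 * ((1 - s) * (1 - 5 * s)) - X)"
        using X by (intro mult_pos_pos) auto
      moreover have "0 \<le> X ^ 3 * s\<^sup>2 * (1 - s) / 48" using X s by simp
      ultimately show ?thesis by linarith
    qed
    also have "\<dots> \<le> cos x"
      using cos_ge_Taylor6[OF x(1)] unfolding pw(1,2) X_def[symmetric] .
    finally show ?thesis .
  qed
  then have "1 - (1 - s) / 2 * X < cos x / cos (q * x)"
    unfolding pos_less_divide_eq[OF cq] by (subst mult.commute)
  then have "1 - cos x / cos (q * x) < (1 - s) / 2 * X" by simp
  then show ?thesis using X by (simp add: X_def s_def pos_divide_less_eq)
qed

text \<open>Here \<open>3 / 8\<close> is \<open>(p\<^sup>2 - 1) / (2 * p\<^sup>2)\<close> at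
  \<open>p = 2\<close>. The product \<open>(1 - X / 8) * (1 - 3 / 8 * X)\<close> exceeds the quartic
  Taylor bound for \<open>cos x\<close> by \<open>X\<^sup>2 / 192\<close>.\<close>

lemma cos_half_quotient_lower:
  fixes x :: real
  assumes x: "0 < x" "x < pi / 2"
  shows "3 / 8 < (1 - cos x / cos (x / 2)) / x\<^sup>2"
proof -
  define X where "X = x\<^sup>2"
  have "x < 2" using x pi_less_4 by simp
  then have X: "0 < X" "X < 4"
    using x power_strict_mono[of x 2 2] by (auto simp: X_def)
  have cx: "cos x > 0" using x by (intro cos_gt_zero_pi) auto
  have ch: "cos (x / 2) > 0" using x by (intro cos_gt_zero_pi) auto
  have T: "cos x \<le> 1 - X / 2 + X\<^sup>2 / 24"
    using cos_le_Taylor4[of x] x by (simp add: X_def flip: power_mult)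
  \<comment> \<open>The positivity of \<open>cos x\<close> replaces a numerical bound on \<open>pi\<close> sharper than \<open>pi < 4\<close>.\<close>
  have F: "X < 8 / 3"
  proof (rule ccontr)
    assume "\<not> X < 8 / 3"
    \<comment> \<open>The convex quadratic \<open>1 - X / 2 + X\<^sup>2 / 24\<close> is
      \<open>-1 / 27\<close> at \<open>8 / 3\<close> and \<open>-1 / 3\<close> at 4. This product
      bounds it by its chord, so it is negative in between.\<close>
    then have "0 \<le> (X - 8 / 3) * (4 - X)" using X by simp
    also have "(X - 8 / 3) * (4 - X) = 20 / 3 * X - X\<^sup>2 - 32 / 3"
      by (simp add: field_simps power2_eq_square)
    finally show False using T cx \<open>\<not> X < 8 / 3\<close> by linarith
  qed
  have "1 - X / 8 < cos (x / 2)"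
    using one_minus_cos_less[of "x / 2"] x by (simp add: X_def power_divide)
  then have "(1 - X / 8) * (1 - 3 / 8 * X) \<le> cos (x / 2) * (1 - 3 / 8 * X)"
    using F by (intro mult_right_mono) auto
  moreover have "cos x < (1 - X / 8) * (1 - 3 / 8 * X)"
  proof -
    have "(1 - X / 8) * (1 - 3 / 8 * X) = 1 - X / 2 + X\<^sup>2 / 24 + X\<^sup>2 / 192"
      by (simp add: field_simps power2_eq_square)
    moreover have "X\<^sup>2 > 0" using X by simp
    ultimately show ?thesis using T by linarith
  qed
  ultimately have "cos x / cos (x / 2) < 1 - 3 / 8 * X"
    using ch by (simp add: pos_divide_less_eq mult.commute)
  then have "3 / 8 * X < 1 - cos x / cos (x / 2)" by simp
  then show ?thesis using X by (simp add: X_def pos_less_divide_eq)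
qed

text \<open>The derivative of \<open>F t / t\<^sup>2\<close> has the sign of
  \<open>t * N t - 2 * F t\<close>. This vanishes at 0 and has derivative
  \<open>t * N1 t - N t\<close>, which vanishes at 0 and has derivative
  \<open>t * N2 t > 0\<close>.\<close>

lemma cos_half_quotient_upper:
  fixes x :: real
  assumes x: "0 < x" "x < pi / 2"
  shows "(1 - cos x / cos (x / 2)) / x\<^sup>2 < 4 / pi\<^sup>2"
proof -
  \<comment> \<open>\<open>F t\<close> is \<open>1 - cos (2 * t) / cos t\<close> after the
    double-angle formula; \<open>N\<close>, \<open>N1\<close>, \<open>N2\<close> are its successive
    derivatives.\<close>
  define F where "F = (\<lambda>t::real. 1 - 2 * cos t + 1 / cos t)"
  define N where "N = (\<lambda>t::real. 2 * sin t + sin t / (cos t)\<^sup>2)"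
  define N1 where "N1 = (\<lambda>t::real. 2 * cos t - 1 / cos t + 2 / (cos t) ^ 3)"
  define N2 where "N2 = (\<lambda>t::real. sin t * (6 / (cos t) ^ 4 - 1 / (cos t)\<^sup>2 - 2))"
  have c: "cos t > 0" if "0 \<le> t" "t < pi / 2" for t :: real
    using that by (intro cos_gt_zero_pi) auto
  have dF: "(F has_real_derivative N t) (at t)" if "0 \<le> t" "t < pi / 2" for t
    unfolding F_def N_def using c[OF that]
    by (auto intro!: derivative_eq_intros simp: field_simps power2_eq_square)
  have dN: "(N has_real_derivative N1 t) (at t)" if "0 \<le> t" "t < pi / 2" for t
  proof -
    have "(N has_real_derivative 2 * cos t + (cos t * (cos t)\<^sup>2 - sin t * (2 * cos t * (- sin t))) / ((cos t)\<^sup>2 * (cos t)\<^sup>2)) (at t)"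
      unfolding N_def using c[OF that]
      by (auto intro!: derivative_eq_intros)
    also have "2 * cos t + (cos t * (cos t)\<^sup>2 - sin t * (2 * cos t * (- sin t))) / ((cos t)\<^sup>2 * (cos t)\<^sup>2) = N1 t"
    proof -
      have "sin t * sin t = 1 - cos t * cos t"
        using sin_squared_eq[of t] by (simp add: power2_eq_square)
      moreover have "cos t * (cos t)\<^sup>2 - sin t * (2 * cos t * (- sin t))
          = cos t * (cos t * cos t + 2 * (sin t * sin t))"
        by (simp add: algebra_simps power2_eq_square)
      ultimately have num: "cos t * (cos t)\<^sup>2 - sin t * (2 * cos t * (- sin t)) = cos t * (2 - (cos t)\<^sup>2)"
        by (simp add: power2_eq_square)
      show ?thesis
        unfolding N1_def num using c[OF that] by (simp add: field_simps power2_eq_square power3_eq_cube)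
    qed
    finally show ?thesis .
  qed
  have dN1: "(N1 has_real_derivative N2 t) (at t)" if "0 \<le> t" "t < pi / 2" for t
    unfolding N1_def N2_def using c[OF that]
    by (auto intro!: derivative_eq_intros simp: field_simps power2_eq_square eval_nat_numeral)
  have N2: "N2 t > 0" if "0 < t" "t < pi / 2" for t
  proof -
    \<comment> \<open>In terms of \<open>k\<close> the bracket of \<open>N2\<close> is the quadratic
      \<open>6 * k\<^sup>2 - k - 2\<close>, which factors.\<close>
    define k where "k = 1 / (cos t)\<^sup>2"
    have "cos t < 1" using cos_monotone_0_pi[of 0 t] that by simp
    then have "(cos t)\<^sup>2 < 1" using c[of t] that by (simp add: power_less_one_iff)
    then have k: "k > 1" using c[of t] that by (simp add: k_def)
    have "6 / (cos t) ^ 4 - 1 / (cos t)\<^sup>2 - 2 = (3 * k - 2) * (2 * k + 1)"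
      using c[of t] that by (simp add: k_def field_simps eval_nat_numeral)
    also have "\<dots> > 0" using k by simp
    finally show ?thesis
      unfolding N2_def using sin_gt_zero[of t] that by simp
  qed
  have G1: "t * N1 t - N t > 0" if "0 < t" "t < pi / 2" for t
  proof (rule pos_if_deriv_pos[of "\<lambda>t. t * N1 t - N t" t "pi / 2" "\<lambda>t. t * N2 t"])
    show "((\<lambda>t. t * N1 t - N t) has_real_derivative s * N2 s) (at s)"
      if "0 \<le> s" "s < pi / 2" for s
      using DERIV_diff[OF DERIV_mult[OF DERIV_ident dN1[OF that]] dN[OF that]]
      by (simp add: mult.commute)
  qed (use that N2 in \<open>auto simp: N_def\<close>)
  have G: "t * N t - 2 * F t > 0" if "0 < t" "t < pi / 2" for t
  proof (rule pos_if_deriv_pos[of "\<lambda>t. t * N t - 2 * F t" t "pi / 2" "\<lambda>t. t * N1 t - N t"])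
    show "((\<lambda>t. t * N t - 2 * F t) has_real_derivative s * N1 s - N s) (at s)"
      if "0 \<le> s" "s < pi / 2" for s
      using DERIV_diff[OF DERIV_mult[OF DERIV_ident dN[OF that]] DERIV_cmult[OF dF[OF that], of 2]]
      by (simp add: mult.commute)
  qed (use that G1 in \<open>auto simp: F_def\<close>)
  \<comment> \<open>The right end \<open>pi / 4\<close> corresponds to \<open>x = pi / 2\<close>,
    where \<open>cos x = 0\<close> and so \<open>F\<close> equals 1.\<close>
  have "F (x / 2) / (x / 2)\<^sup>2 < F (pi / 4) / (pi / 4)\<^sup>2"
  proof (rule DERIV_pos_imp_increasing[of "x / 2" "pi / 4" "\<lambda>t. F t / t\<^sup>2"])
    show "\<exists>y. ((\<lambda>t. F t / t\<^sup>2) has_real_derivative y) (at t) \<and> 0 < y"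
      if "x / 2 \<le> t" "t \<le> pi / 4" for t
    proof (intro exI conjI)
      have t: "0 < t" "t < pi / 2" using that x by auto
      show "((\<lambda>t. F t / t\<^sup>2) has_real_derivative (t * N t - 2 * F t) / t ^ 3) (at t)"
        using t by (auto intro!: derivative_eq_intros dF simp: field_simps eval_nat_numeral)
      show "0 < (t * N t - 2 * F t) / t ^ 3" using G t by simp
    qed
  qed (use x in auto)
  moreover have F_eq: "F t = 1 - cos (2 * t) / cos t" if "0 < t" "t < pi / 2" for t
    unfolding F_def cos_double_cos using c[of t] that by (simp add: field_simps power2_eq_square)
  moreover have "F (x / 2) = 1 - cos x / cos (x / 2)" "F (pi / 4) = 1"
    using x F_eq[of "x / 2"] F_eq[of "pi / 4"] by simp_all
  ultimately have "4 * ((1 - cos x / cos (x / 2)) / x\<^sup>2) < 4 * (4 / pi\<^sup>2)"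
    by (simp add: power_divide mult.commute)
  then show ?thesis by (simp only: mult_less_cancel_left_pos zero_less_numeral)
qed

theorem theorem2:
  fixes x :: real
  assumes "0 < x" and "x < pi / 2"
  shows
    "(\<forall>p::int. p \<ge> 3 \<longrightarrow>
        (4 / pi\<^sup>2 < (1 - cos x / cos (x / real_of_int p)) / x\<^sup>2 \<and>
         (1 - cos x / cos (x / real_of_int p)) / x\<^sup>2
           < ((real_of_int p)\<^sup>2 - 1) / (2 * (real_of_int p)\<^sup>2)) \<and>
        (4 / pi\<^sup>2 * (real_of_int p - csc (pi / (2 * real_of_int p)))
           < (real_of_int p - sin x / sin (x / real_of_int p)) / x\<^sup>2 \<and>
         (real_of_int p - sin x / sin (x / real_of_int p)) / x\<^sup>2
           < ((real_of_int p)\<^sup>2 - 1) / (6 * real_of_int p))) \<and>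
     (\<forall>p::int. p = 2 \<longrightarrow>
        (((real_of_int p)\<^sup>2 - 1) / (2 * (real_of_int p)\<^sup>2)
           < (1 - cos x / cos (x / real_of_int p)) / x\<^sup>2 \<and>
         (1 - cos x / cos (x / real_of_int p)) / x\<^sup>2 < 4 / pi\<^sup>2) \<and>
        (4 / pi\<^sup>2 * (real_of_int p - csc (pi / (2 * real_of_int p)))
           < (real_of_int p - sin x / sin (x / real_of_int p)) / x\<^sup>2 \<and>
         (real_of_int p - sin x / sin (x / real_of_int p)) / x\<^sup>2
           < ((real_of_int p)\<^sup>2 - 1) / (6 * real_of_int p)))"
proof (intro conjI allI impI)
  fix p :: int
  assume p: "p \<ge> 3"
  define q where "q = 1 / real_of_int p"
  have q: "0 < q" "q \<le> 1 / 3" "x / real_of_int p = q * x"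
    using p by (auto simp: q_def field_simps)
  have q2: "((real_of_int p)\<^sup>2 - 1) / (2 * (real_of_int p)\<^sup>2) = (1 - q\<^sup>2) / 2"
    using p by (simp add: q_def field_simps)
  show "4 / pi\<^sup>2 < (1 - cos x / cos (x / real_of_int p)) / x\<^sup>2"
    unfolding q(3) by (intro cos_quotient_lower assms q)
  show "(1 - cos x / cos (x / real_of_int p)) / x\<^sup>2
      < ((real_of_int p)\<^sup>2 - 1) / (2 * (real_of_int p)\<^sup>2)"
    unfolding q2 q(3) by (intro cos_quotient_upper assms q)
next
  fix p :: int
  assume "p = 2"
  then show "((real_of_int p)\<^sup>2 - 1) / (2 * (real_of_int p)\<^sup>2)
      < (1 - cos x / cos (x / real_of_int p)) / x\<^sup>2"
    and "(1 - cos x / cos (x / real_of_int p)) / x\<^sup>2 < 4 / pi\<^sup>2"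
    using cos_half_quotient_lower[OF assms] cos_half_quotient_upper[OF assms] by simp_all
next
  fix p :: int
  assume "p \<ge> 3"
  \<comment> \<open>The cosine sum has \<open>n\<close> terms, so the sine bounds are stated for
    naturals and transferred through \<open>nat p\<close>.\<close>
  then have p: "2 \<le> nat p" "real (nat p) = real_of_int p" by auto
  show "4 / pi\<^sup>2 * (real_of_int p - csc (pi / (2 * real_of_int p)))
      < (real_of_int p - sin x / sin (x / real_of_int p)) / x\<^sup>2"
    and "(real_of_int p - sin x / sin (x / real_of_int p)) / x\<^sup>2
      < ((real_of_int p)\<^sup>2 - 1) / (6 * real_of_int p)"
    using sin_quotient_bounds[OF assms p(1)] unfolding p(2) .
next
  fix p :: int
  assume "p = 2"
  then have p: "2 \<le> nat p" "real (nat p) = real_of_int p" by auto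
  show "4 / pi\<^sup>2 * (real_of_int p - csc (pi / (2 * real_of_int p)))
      < (real_of_int p - sin x / sin (x / real_of_int p)) / x\<^sup>2"
    and "(real_of_int p - sin x / sin (x / real_of_int p)) / x\<^sup>2
      < ((real_of_int p)\<^sup>2 - 1) / (6 * real_of_int p)"
    using sin_quotient_bounds[OF assms p(1)] unfolding p(2) .
qed

end
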